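(* Let $\mathbb F_q$ be a finite field and suppose $B \subseteq \mathbb F_q^m$ is $C$-weakly Sidorenko, with $p := \omega^\to(B) \geq 1$. Then, as $t \to \infty$, \[R_q(2,t) = O\big(t\, C^{t/p}\big),\] where the implied constant may depend on $B$, $C$ and $q$.
   Context: An affine relation on $x_1,\ldots,x_k$ is an equation $\sum_i \lambda_i x_i = 0$ with $\lambda_i \in \mathbb F_q$, $\sum_i \lambda_i = 0$; a set is affinely independent if it has no such relation with some $\lambda_i \neq 0$, and $\mathrm{rank}_{\mathrm{aff}}(B)$ is the size of a maximal affinely independent subset of $B$. For $B \subseteq \mathbb F_q^m$, $A \subseteq \mathbb F_q^n$, an affine homomorphism $B \to A$ is a map extending to an affine map $\mathbb F_q^m \to \mathbb F_q^n$; $\mathrm{hom}_{\mathrm{aff}}(B,A)$ is their number. $B$ is $C$-weakly Sidorenko if for every $n$ and every $A \subseteq \mathbb F_q^n$ with $|A| = \alpha q^n$, $\mathrm{hom}_{\mathrm{aff}}(B,A) \geq \alpha^C (q^n)^{\mathrm{rank}_{\mathrm{aff}}(B)}$. The direction set of $B$ is $B^\to := \{d \in \mathbb F_q^m : \exists x \text{ with } x + \lambda d \in B \text{ for all } \lambda \in \mathbb F_q\}$, and $\omega^\to(B)$ is the largest dimension of a linear subspace contained in $B^\to \cup \{0\}$. $R_q(2,t)$ is the minimum $n$ such that for every red-blue coloring of the $1$-dimensional linear subspaces of $\mathbb F_q^n$, there is either a $2$-dimensional linear subspace all of whose $1$-dimensional subspaces are red, or a $t$-dimensional linear subspace all of whose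 $1$-dimensional subspaces are blue. *)

theory Defs
  imports Complex_Main "HOL-Library.Landau_Symbols" "HOL-Library.FuncSet"
begin

text \<open>Vectors of F_q^n are represented as functions nat => 'a vanishing at
  all indices >= n.  The field F_q is a finite field type 'a, q = CARD('a).\<close>

definition vecs :: "nat \<Rightarrow> (nat \<Rightarrow> 'a::zero) set" where
  "vecs n = {v. \<forall>i\<ge>n. v i = 0}"

definition lincomb :: "((nat \<Rightarrow> 'a::field) \<Rightarrow> 'a) \<Rightarrow> (nat \<Rightarrow> 'a) set \<Rightarrow> (nat \<Rightarrow> 'a)" where
  "lincomb c S = (\<lambda>i. \<Sum>x\<in>S. c x * x i)"

definition aff_indep :: "(nat \<Rightarrow> 'a::field) set \<Rightarrow> bool" where
  "aff_indep S \<longleftrightarrow> finite S \<and>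
     \<not> (\<exists>c. (\<Sum>x\<in>S. c x) = 0 \<and> lincomb c S = (\<lambda>_. 0) \<and> (\<exists>x\<in>S. c x \<noteq> 0))"

definition rank_aff :: "(nat \<Rightarrow> 'a::field) set \<Rightarrow> nat" where
  "rank_aff B = Max {card S | S. S \<subseteq> B \<and> aff_indep S}"

definition affine_maps :: "nat \<Rightarrow> nat \<Rightarrow> ((nat \<Rightarrow> 'a::field) \<Rightarrow> (nat \<Rightarrow> 'a)) set" where
  "affine_maps m n = {f. \<exists>(M::nat \<Rightarrow> nat \<Rightarrow> 'a) (b::nat \<Rightarrow> 'a).
      \<forall>x\<in>vecs m. f x = (\<lambda>i. if i < n then b i + (\<Sum>j<m. M i j * x j) else 0)}"

definition hom_aff :: "nat \<Rightarrow> nat \<Rightarrow> (nat \<Rightarrow> 'a::field) set \<Rightarrow> (nat \<Rightarrow> 'a) set \<Rightarrow> nat" where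
  "hom_aff m n B A = card {\<phi>. \<phi> \<in> extensional B \<and> \<phi> ` B \<subseteq> A \<and>
      (\<exists>f\<in>affine_maps m n. \<forall>x\<in>B. \<phi> x = f x)}"

definition weakly_sidorenko :: "real \<Rightarrow> nat \<Rightarrow> (nat \<Rightarrow> 'a::{finite,field}) set \<Rightarrow> bool" where
  "weakly_sidorenko C m B \<longleftrightarrow>
     (\<forall>n (A::(nat \<Rightarrow> 'a) set). A \<subseteq> vecs n \<longrightarrow>
        real (hom_aff m n B A) \<ge>
          (real (card A) / real (card (UNIV :: 'a set)) ^ n) powr C * (real (card (UNIV :: 'a set)) ^ n) ^ rank_aff B)"

definition direction_set :: "nat \<Rightarrow> (nat \<Rightarrow> 'a::field) set \<Rightarrow> (nat \<Rightarrow> 'a) set" where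
  "direction_set m B = {d \<in> vecs m. \<exists>x\<in>vecs m. \<forall>c. (\<lambda>i. x i + c * d i) \<in> B}"

definition lin_indep :: "(nat \<Rightarrow> 'a::field) set \<Rightarrow> bool" where
  "lin_indep S \<longleftrightarrow> finite S \<and>
     \<not> (\<exists>c. lincomb c S = (\<lambda>_. 0) \<and> (\<exists>x\<in>S. c x \<noteq> 0))"

definition lspan :: "(nat \<Rightarrow> 'a::field) set \<Rightarrow> (nat \<Rightarrow> 'a) set" where
  "lspan S = {lincomb c S | c. True}"

definition subspaces_dim :: "nat \<Rightarrow> nat \<Rightarrow> (nat \<Rightarrow> 'a::field) set set" where
  "subspaces_dim n k = {lspan S | S. S \<subseteq> vecs n \<and> lin_indep S \<and> card S = k}"

definition omega_dir :: "nat \<Rightarrow> (nat \<Rightarrow> 'a::field) set \<Rightarrow> nat" where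
  "omega_dir m B = Max {k. \<exists>V\<in>subspaces_dim m k. V \<subseteq> direction_set m B \<union> {\<lambda>_. 0}}"

text \<open>R_q(2,t); a red-blue colouring of the 1-dimensional subspaces is a
  predicate col on sets of vectors (True = red), only its values on lines matter.\<close>
definition ramsey_q :: "'a::{finite,field} itself \<Rightarrow> nat \<Rightarrow> nat \<Rightarrow> nat" where
  "ramsey_q _ s t = (LEAST n. \<forall>col :: (nat \<Rightarrow> 'a) set \<Rightarrow> bool.
      (\<exists>W\<in>subspaces_dim n s. \<forall>v\<in>W - {\<lambda>_. 0}. col (lspan {v})) \<or>
      (\<exists>W\<in>subspaces_dim n t. \<forall>v\<in>W - {\<lambda>_. 0}. \<not> col (lspan {v})))"

end

theory Submission
  imports Defs
begin

text \<open>
  Let \<open>X\<close> be the set of red nonzero vectors of \<open>F_q^n\<close>. If \<open>X\<close> has density below about \<open>q^(-t)\<close>, a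
  greedy choice of basis vectors yields a blue \<open>t\<close>-dimensional subspace. Otherwise consider a
  direction \<open>v\<close> of a line contained in \<open>X\<close>, say \<open>z + c v\<close> is in \<open>X\<close> for all \<open>c\<close>: if \<open>v\<close> were red, then
  the span of \<open>z\<close> and \<open>v\<close> would be a red plane, so \<open>v\<close> is blue, and it suffices to find a
  \<open>t\<close>-dimensional space of directions of \<open>X\<close>.

  By pigeonhole over the translation classes of homomorphisms, a set of density \<open>\<alpha>\<close> contains
  \<open>y + L(B)\<close> for all \<open>y\<close> in a translate of a set of density about \<open>\<alpha>^C\<close>, with one linear \<open>L\<close>. Repeating
  this inside the new set \<open>k\<close> times, \<open>k\<close> about \<open>t/p\<close>, gives a \<open>p k\<close>-dimensional space of directions, at
  the cost of the density falling to \<open>\<alpha>^(C^k)\<close>. This works as long as \<open>q^n\<close> beats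
  \<open>(q^t)^(C^k)\<close>, that is, for \<open>n\<close> of order \<open>t C^(t/p)\<close>.
\<close>

section \<open>Vectors, spans and linear independence over a finite field\<close>

lemma two_le_card_field: "2 \<le> card (UNIV :: 'a::{finite,field} set)"
proof -
  have "card {0, 1::'a} \<le> card (UNIV :: 'a set)" by (intro card_mono) auto
  then show ?thesis by simp
qed

lemma vecs_bij:
  "bij_betw (\<lambda>v. restrict v {..<n}) (vecs n) ({..<n} \<rightarrow>\<^sub>E (UNIV :: 'a::zero set))"
  by (rule bij_betw_byWitness[where f' = "\<lambda>g i. if i < n then g i else 0"])
    (auto simp: vecs_def fun_eq_iff PiE_def extensional_def)

lemma finite_vecs: "finite (vecs n :: (nat \<Rightarrow> 'a::{finite,field}) set)"
  using bij_betw_finite[OF vecs_bij[where 'a='a and n=n]] by (simp add: finite_PiE)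

lemma card_vecs: "card (vecs n :: (nat \<Rightarrow> 'a::{finite,field}) set) = card (UNIV :: 'a set) ^ n"
  using bij_betw_same_card[OF vecs_bij[where 'a='a and n=n]] by (simp add: card_PiE)

lemma zero_in_vecs: "(\<lambda>_. 0) \<in> vecs n"
  by (simp add: vecs_def)

lemma vecs_lincomb: "S \<subseteq> vecs n \<Longrightarrow> lincomb c S \<in> vecs n"
  by (auto simp: vecs_def lincomb_def intro!: sum.neutral)

lemma lspan_subset_vecs: "S \<subseteq> vecs n \<Longrightarrow> lspan S \<subseteq> vecs n"
  by (auto simp: lspan_def vecs_lincomb)

lemma lincomb_in_lspan: "lincomb c S \<in> lspan S"
  by (auto simp: lspan_def)

lemma zero_in_lspan: "(\<lambda>_. 0) \<in> lspan S"
  using lincomb_in_lspan[of "\<lambda>_. 0" S] by (simp add: lincomb_def)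

lemma in_lspan: "finite S \<Longrightarrow> s \<in> S \<Longrightarrow> s \<in> lspan S"
proof -
  assume "finite S" "s \<in> S"
  then have "lincomb (\<lambda>x. if x = s then 1 else 0) S = s"
    by (auto simp: lincomb_def if_distrib[where f="\<lambda>a. a * _"] cong: if_cong)
  then show ?thesis by (metis lincomb_in_lspan)
qed

lemma lspan_add:
  assumes "u \<in> lspan S" "v \<in> lspan S"
  shows "(\<lambda>i. u i + c * v i) \<in> lspan S"
proof -
  obtain a b where "u = lincomb a S" "v = lincomb b S"
    using assms by (auto simp: lspan_def)
  then have "(\<lambda>i. u i + c * v i) = lincomb (\<lambda>x. a x + c * b x) S"
    by (simp add: lincomb_def sum.distrib sum_distrib_left algebra_simps)
  then show ?thesis by (metis lincomb_in_lspan)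
qed

lemma lspan_scale: "v \<in> lspan S \<Longrightarrow> (\<lambda>i. c * v i) \<in> lspan S"
  using lspan_add[OF zero_in_lspan, of v S c] by simp

lemma lspan_mono: "finite T \<Longrightarrow> S \<subseteq> T \<Longrightarrow> lspan S \<subseteq> lspan T"
proof
  fix v assume *: "finite T" "S \<subseteq> T" "v \<in> lspan S"
  then obtain c where c: "v = lincomb c S" by (auto simp: lspan_def)
  have "v = lincomb (\<lambda>x. if x \<in> S then c x else 0) T"
    unfolding c lincomb_def using * by (intro ext sum.mono_neutral_cong_left) auto
  then show "v \<in> lspan T" by (metis lincomb_in_lspan)
qed

lemma lin_indep_mono: 
  assumes "lin_indep T" "S \<subseteq> T"
  shows "lin_indep S"
proof -
  have fin: "finite T" using assms by (simp add: lin_indep_def)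
  have "c x = 0" if "lincomb c S = (\<lambda>_. 0)" "x \<in> S" for c x
  proof -
    have "lincomb (\<lambda>x. if x \<in> S then c x else 0) T = lincomb c S"
      unfolding lincomb_def using fin assms(2)
      by (intro ext sum.mono_neutral_cong_right) auto
    then have "(if x \<in> S then c x else 0) = 0"
      using assms that unfolding lin_indep_def by (metis (mono_tags, lifting) subsetD)
    then show ?thesis using that by simp
  qed
  then show ?thesis
    using fin assms(2) by (auto simp: lin_indep_def intro: finite_subset)
qed

lemma lincomb_insert:
  "finite S \<Longrightarrow> v \<notin> S \<Longrightarrow> lincomb c (insert v S) = (\<lambda>i. c v * v i + lincomb c S i)"
  by (simp add: lincomb_def)

lemma lin_indep_insert:
  assumes "lin_indep S" "v \<notin> lspan S"
  shows "lin_indep (insert v S)"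
proof -
  have fin: "finite S" using assms by (simp add: lin_indep_def)
  have v: "v \<notin> S" using assms in_lspan[OF fin] by blast
  have "c x = 0" if c: "lincomb c (insert v S) = (\<lambda>_. 0)" and x: "x \<in> insert v S" for c x
  proof -
    have eq: "c v * v i = - lincomb c S i" for i
      using fun_cong[OF c, of i] by (simp add: lincomb_insert[OF fin v] add_eq_0_iff2)
    have cv: "c v = 0"
    proof (rule ccontr)
      assume nz: "c v \<noteq> 0"
      have "v = (\<lambda>i. (- inverse (c v)) * lincomb c S i)"
        using eq nz by (auto simp: fun_eq_iff field_simps)
      then show False using assms(2) lspan_scale[OF lincomb_in_lspan] by metis
    qed
    then have "lincomb c S = (\<lambda>_. 0)" using eq by (auto simp: fun_eq_iff)
    then show ?thesis using assms(1) x cv by (auto simp: lin_indep_def)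
  qed
  then show ?thesis using fin by (auto simp: lin_indep_def)
qed

lemma lspan_insertE:
  assumes "finite S" "w \<in> lspan (insert v S)"
  obtains c u where "u \<in> lspan S" "w = (\<lambda>i. c * v i + u i)"
proof (cases "v \<in> S")
  case True
  then show ?thesis using assms that[of w 0] by (simp add: insert_absorb)
next
  case False
  obtain c where "w = lincomb c (insert v S)" using assms by (auto simp: lspan_def)
  then show ?thesis
    using that[OF lincomb_in_lspan] by (simp add: lincomb_insert[OF assms(1) False])
qed

lemma lspan_singleton: "lspan {v} = {(\<lambda>i. c * v i) | c. True}"
  by (auto simp: lspan_def lincomb_def)

lemma lspan_singleton_scale:
  assumes "c \<noteq> (0::'a::field)"
  shows "lspan {\<lambda>i. c * v i} = lspan {v}"
proof -
  have "\<exists>b. (\<lambda>i. a * v i) = (\<lambda>i. b * (c * v i))" for a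
    using assms by (intro exI[of _ "a / c"]) simp
  moreover have "\<exists>b. (\<lambda>i. a * (c * v i)) = (\<lambda>i. b * v i)" for a
    by (intro exI[of _ "a * c"]) (simp add: mult.assoc)
  ultimately show ?thesis by (auto simp: lspan_singleton)
qed

lemma card_lspan_le:
  assumes "finite (S :: (nat \<Rightarrow> 'a::{finite,field}) set)"
  shows "finite (lspan S)" "card (lspan S) \<le> card (UNIV :: 'a set) ^ card S"
proof -
  have sub: "lspan S \<subseteq> (\<lambda>c. lincomb c S) ` (S \<rightarrow>\<^sub>E UNIV)"
  proof
    fix v assume "v \<in> lspan S"
    then obtain c where "v = lincomb c S" by (auto simp: lspan_def)
    then have "v = lincomb (restrict c S) S" by (simp add: lincomb_def)
    then show "v \<in> (\<lambda>c. lincomb c S) ` (S \<rightarrow>\<^sub>E UNIV)"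
      by (intro image_eqI[of _ _ "restrict c S"]) auto
  qed
  have fin: "finite (S \<rightarrow>\<^sub>E (UNIV :: 'a set))" using assms by (simp add: finite_PiE)
  show "finite (lspan S)" using sub fin by (rule finite_surj[rotated])
  have "card (lspan S) \<le> card (S \<rightarrow>\<^sub>E (UNIV :: 'a set))"
    using surj_card_le[OF fin sub] .
  then show "card (lspan S) \<le> card (UNIV :: 'a set) ^ card S"
    using assms by (simp add: card_PiE)
qed

section \<open>Greedy choice of a subspace avoiding a sparse set\<close>

text \<open>Used with \<open>X\<close> the red vectors, which gives a blue subspace. If the span of
  \<open>S\<close> and \<open>v\<close> meets \<open>X\<close> but that of \<open>S\<close> does
  not, scaling makes the coefficient of \<open>v\<close> equal to 1, so \<open>v\<close> is an
  element of \<open>X\<close> minus one of \<open>lspan S\<close>. Together with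
  \<open>lspan S\<close> itself this forbids at most \<open>q^j * (card X + 1)\<close> vectors,
  fewer than \<open>q^n\<close> while \<open>j < t\<close>.\<close>

lemma exists_subspace_avoiding:
  fixes X :: "(nat \<Rightarrow> 'a::{finite,field}) set"
  assumes X: "X \<subseteq> vecs n" "(\<lambda>_. 0) \<notin> X"
    and scale: "\<And>c v. c \<noteq> 0 \<Longrightarrow> v \<in> X \<Longrightarrow> (\<lambda>i. c * v i) \<in> X"
    and small: "card (UNIV :: 'a set) ^ t * (card X + 1) \<le> card (UNIV :: 'a set) ^ n"
  shows "j \<le> t \<Longrightarrow> \<exists>S\<subseteq>vecs n. lin_indep S \<and> card S = j \<and> lspan S \<inter> X = {}"
proof (induction j)
  case 0
  show ?case
    using X by (intro exI[of _ "{}"]) (auto simp: lin_indep_def lspan_def lincomb_def)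
next
  case (Suc j)
  let ?q = "card (UNIV :: 'a set)"
  obtain S where S: "S \<subseteq> vecs n" "lin_indep S" "card S = j" "lspan S \<inter> X = {}"
    using Suc by auto
  have finS: "finite S" using S by (simp add: lin_indep_def)
  have finX: "finite X" using X finite_vecs finite_subset by blast
  \<comment> \<open>The choices of \<open>v\<close> for which the span of \<open>S\<close> and \<open>v\<close> meets \<open>X\<close> or \<open>v\<close> is dependent on \<open>S\<close>\<close>
  define F where "F = (\<lambda>(x, u) i. x i - u i) ` (X \<times> lspan S) \<union> lspan S"
  have finF: "finite F" using finX card_lspan_le[OF finS] by (simp add: F_def)
  have "card F \<le> card (X \<times> lspan S) + card (lspan S)"
    unfolding F_def using finX card_lspan_le[OF finS]
    by (intro order.trans[OF card_Un_le] add_mono card_image_le) auto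
  also have "\<dots> = card (lspan S) * (card X + 1)" by (simp add: card_cartesian_product)
  also have "\<dots> \<le> ?q ^ j * (card X + 1)"
    using card_lspan_le[OF finS] S by (intro mult_right_mono) auto
  also have "\<dots> < ?q ^ t * (card X + 1)"
    using Suc two_le_card_field[where 'a='a] by (intro mult_strict_right_mono power_strict_increasing) auto
  also have "\<dots> \<le> card (vecs n :: (nat \<Rightarrow> 'a) set)" using small by (simp add: card_vecs)
  finally obtain v where v: "v \<in> vecs n" "v \<notin> F"
    using card_mono[OF finF] by (metis linorder_not_less subsetI)
  have "w \<notin> X" if w: "w \<in> lspan (insert v S)" for w
  proof
    assume wX: "w \<in> X"
    obtain c u where u: "u \<in> lspan S" and w: "w = (\<lambda>i. c * v i + u i)"
      using lspan_insertE[OF finS w] .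
    show False
    proof (cases "c = 0")
      case True
      then show ?thesis using S u w wX by auto
    next
      case False
      have "(\<lambda>i. inverse c * w i) \<in> X" using False wX scale by simp
      moreover have "v = (\<lambda>i. inverse c * w i - inverse c * u i)"
        using False w by (auto simp: fun_eq_iff field_simps)
      ultimately have "v \<in> F"
        unfolding F_def using lspan_scale[OF u, of "inverse c"] by (intro UnI1) force
      then show ?thesis using v by simp
    qed
  qed
  moreover have "v \<notin> lspan S" using v by (simp add: F_def)
  moreover have "v \<notin> S" using calculation in_lspan[OF finS] by blast
  ultimately show ?case
    using S v finS lin_indep_insert[OF S(2)] by (intro exI[of _ "insert v S"]) auto
qed


section \<open>Affine bases and counting affine homomorphisms\<close>

text \<open>A largest independent \<open>S\<close> works: for \<open>b\<close> outside it, a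
  relation on \<open>insert b S\<close> has a nonzero coefficient at \<open>b\<close>, as otherwise
  it would be a relation on \<open>S\<close>. Solving for \<open>b\<close> gives coefficients of sum
  1.\<close>

lemma exists_affine_basis:
  assumes fin: "finite (B :: (nat \<Rightarrow> 'a::field) set)"
  obtains S where "S \<subseteq> B" "aff_indep S" "card S = rank_aff B"
    "\<And>b. b \<in> B \<Longrightarrow> \<exists>a. sum a S = 1 \<and> b = lincomb a S"
proof -
  let ?K = "{card S | S. S \<subseteq> B \<and> aff_indep S}"
  have finK: "finite ?K"
    by (rule finite_subset[of _ "{..card B}"]) (auto intro: card_mono[OF fin])
  have "0 \<in> ?K" by (intro CollectI exI[of _ "{}"]) (auto simp: aff_indep_def)
  then have "Max ?K \<in> ?K" using finK by (intro Max_in) auto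
  then obtain S where S: "S \<subseteq> B" "aff_indep S" "card S = rank_aff B"
    by (auto simp: rank_aff_def)
  have finS: "finite S" using S by (simp add: aff_indep_def)
  have "\<exists>a. sum a S = 1 \<and> b = lincomb a S" if b: "b \<in> B" for b
  proof (cases "b \<in> S")
    case True
    then have "sum (\<lambda>x. if x = b then 1 else (0::'a)) S = 1"
      "lincomb (\<lambda>x. if x = b then 1 else 0) S = b"
      using finS by (auto simp: lincomb_def if_distrib[where f="\<lambda>a. a * _"] cong: if_cong)
    then show ?thesis by metis
  next
    case False
    have "\<not> aff_indep (insert b S)"
    proof
      assume "aff_indep (insert b S)"
      then have "card (insert b S) \<in> ?K" using S b by auto
      then have "card (insert b S) \<le> rank_aff B"
        unfolding rank_aff_def using finK by (rule Max_ge[rotated])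
      then show False using S False finS by simp
    qed
    then obtain c where c: "sum c (insert b S) = 0" "lincomb c (insert b S) = (\<lambda>_. 0)"
      "\<exists>x\<in>insert b S. c x \<noteq> 0"
      using finS by (auto simp: aff_indep_def)
    have eq: "c b + sum c S = 0" "\<And>i. c b * b i + lincomb c S i = 0"
      using c(1) fun_cong[OF c(2)] False finS by (auto simp: lincomb_insert)
    have nz: "c b \<noteq> 0"
    proof
      assume "c b = 0"
      then have "sum c S = 0" "lincomb c S = (\<lambda>_. 0)" "\<exists>x\<in>S. c x \<noteq> 0"
        using eq c by (auto simp: fun_eq_iff)
      then show False using S by (auto simp: aff_indep_def)
    qed
    let ?a = "\<lambda>s. - (c s / c b)"
    have "sum ?a S = - (sum c S / c b)" by (simp add: sum_negf sum_divide_distrib)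
    also have "\<dots> = 1" using eq(1) nz by (simp add: add_eq_0_iff field_simps)
    finally have "sum ?a S = 1" .
    moreover have "b = lincomb ?a S"
    proof
      fix i
      have "lincomb ?a S i = - (lincomb c S i / c b)"
        by (simp add: lincomb_def sum_negf sum_divide_distrib)
      also have "\<dots> = b i" using eq(2)[of i] nz by (simp add: add_eq_0_iff field_simps)
      finally show "b i = lincomb ?a S i" by simp
    qed
    ultimately show ?thesis by metis
  qed
  then show ?thesis using that S by blast
qed

text \<open>The linear part of an affine map. New directions arise as images of old ones under
  it.\<close>

definition matvec :: "nat \<Rightarrow> nat \<Rightarrow> (nat \<Rightarrow> nat \<Rightarrow> 'a::field) \<Rightarrow> (nat \<Rightarrow> 'a) \<Rightarrow> (nat \<Rightarrow> 'a)" where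
  "matvec n m M x = (\<lambda>i. if i < n then \<Sum>j<m. M i j * x j else 0)"

lemma matvec_in_vecs: "matvec n m M x \<in> vecs n"
  by (simp add: matvec_def vecs_def)

lemma matvec_zero: "matvec n m M (\<lambda>_. 0) = (\<lambda>_. 0)"
  by (auto simp: matvec_def)

lemma matvec_add:
  "matvec n m M (\<lambda>i. u i + c * v i) = (\<lambda>i. matvec n m M u i + c * matvec n m M v i)"
  by (auto simp: matvec_def sum.distrib sum_distrib_left algebra_simps)

lemma matvec_lincomb:
  "matvec n m M (lincomb c S) i = (\<Sum>s\<in>S. c s * matvec n m M s i)"
proof (cases "i < n")
  case True
  have "matvec n m M (lincomb c S) i = (\<Sum>j<m. \<Sum>s\<in>S. M i j * (c s * s j))"
    using True by (simp add: matvec_def lincomb_def sum_distrib_left)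
  also have "\<dots> = (\<Sum>s\<in>S. \<Sum>j<m. M i j * (c s * s j))" by (rule sum.swap)
  also have "\<dots> = (\<Sum>s\<in>S. c s * matvec n m M s i)"
    using True by (simp add: matvec_def sum_distrib_left mult.left_commute)
  finally show ?thesis .
qed (simp add: matvec_def)

text \<open>The set that \<open>hom_aff\<close> counts, named so that it can be thinned out and
  split into translation classes.\<close>

definition aff_homs :: "nat \<Rightarrow> nat \<Rightarrow> (nat \<Rightarrow> 'a::field) set \<Rightarrow> (nat \<Rightarrow> 'a) set
    \<Rightarrow> ((nat \<Rightarrow> 'a) \<Rightarrow> (nat \<Rightarrow> 'a)) set" where
  "aff_homs m n B A = {\<phi>. \<phi> \<in> extensional B \<and> \<phi> ` B \<subseteq> A \<and>
     (\<exists>f\<in>affine_maps m n. \<forall>x\<in>B. \<phi> x = f x)}"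

lemma hom_aff_eq_card: "hom_aff m n B A = card (aff_homs m n B A)"
  by (simp add: hom_aff_def aff_homs_def)

lemma aff_homs_subset_PiE: "aff_homs m n B A \<subseteq> (B \<rightarrow>\<^sub>E A)"
  by (auto simp: aff_homs_def PiE_def simp del: PiE_singleton)

lemma finite_aff_homs:
  assumes "finite B" "finite A"
  shows "finite (aff_homs m n B A)"
  using finite_subset[OF aff_homs_subset_PiE] assms finite_PiE by metis

lemma aff_homsE:
  assumes "\<phi> \<in> aff_homs m n B A" "B \<subseteq> vecs m"
  obtains M w where "w \<in> vecs n" "\<And>x. x \<in> B \<Longrightarrow> \<phi> x = (\<lambda>i. matvec n m M x i + w i)"
proof -
  obtain f where f: "f \<in> affine_maps m n" "\<And>x. x \<in> B \<Longrightarrow> \<phi> x = f x"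
    using assms by (auto simp: aff_homs_def)
  then obtain M b where
    Mb: "\<And>x. x \<in> vecs m \<Longrightarrow> f x = (\<lambda>i. if i < n then b i + (\<Sum>j<m. M i j * x j) else 0)"
    by (auto simp: affine_maps_def)
  define w where "w = (\<lambda>i. if i < n then b i else 0)"
  have "w \<in> vecs n" by (simp add: w_def vecs_def)
  moreover have "\<phi> x = (\<lambda>i. matvec n m M x i + w i)" if "x \<in> B" for x
    using f(2)[OF that] Mb[of x] that assms(2) by (auto simp: w_def matvec_def fun_eq_iff)
  ultimately show ?thesis using that by blast
qed

text \<open>The translation part survives because the coefficients sum to 1.\<close>

lemma aff_homs_combination:
  assumes "\<phi> \<in> aff_homs m n B A" "B \<subseteq> vecs m" "S \<subseteq> B" "lincomb a S \<in> B" "sum a S = 1"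
  shows "\<phi> (lincomb a S) i = (\<Sum>s\<in>S. a s * \<phi> s i)"
proof -
  obtain M w where Mw: "\<And>x. x \<in> B \<Longrightarrow> \<phi> x = (\<lambda>i. matvec n m M x i + w i)"
    using aff_homsE[OF assms(1,2)] by blast
  have "\<phi> (lincomb a S) i = (\<Sum>s\<in>S. a s * matvec n m M s i) + w i"
    using Mw[OF assms(4)] by (simp add: matvec_lincomb)
  also have "\<dots> = (\<Sum>s\<in>S. a s * matvec n m M s i) + (\<Sum>s\<in>S. a s) * w i"
    using assms by simp
  also have "\<dots> = (\<Sum>s\<in>S. a s * (matvec n m M s i + w i))"
    by (simp add: sum.distrib sum_distrib_right distrib_left)
  also have "\<dots> = (\<Sum>s\<in>S. a s * \<phi> s i)"
    using Mw assms(3) by (intro sum.cong) auto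
  finally show ?thesis .
qed

lemma aff_homs_eqI:
  assumes "\<phi> \<in> aff_homs m n B A" "\<psi> \<in> aff_homs m n B A" "B \<subseteq> vecs m" "S \<subseteq> B"
    and basis: "\<And>b. b \<in> B \<Longrightarrow> \<exists>a. sum a S = 1 \<and> b = lincomb a S"
    and eq: "\<And>s. s \<in> S \<Longrightarrow> \<phi> s = \<psi> s"
  shows "\<phi> = \<psi>"
proof
  fix b show "\<phi> b = \<psi> b"
  proof (cases "b \<in> B")
    case True
    then obtain a where a: "sum a S = 1" "b = lincomb a S" using basis by blast
    have "\<phi> b i = \<psi> b i" for i
      using aff_homs_combination[OF assms(1,3,4)] aff_homs_combination[OF assms(2,3,4)]
        a True eq by simp
    then show ?thesis by blast
  next
    case False
    then show ?thesis using assms by (auto simp: aff_homs_def extensional_def)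
  qed
qed

lemma aff_homs_in_vecs:
  "\<phi> \<in> aff_homs m n B A \<Longrightarrow> A \<subseteq> vecs n \<Longrightarrow> x \<in> B \<Longrightarrow> \<phi> x \<in> vecs n"
  by (auto simp: aff_homs_def)

text \<open>A homomorphism has \<open>rank_aff B\<close> free values, those on an affine basis.
  Confining one difference of values to \<open>V\<close> costs one of them: \<open>card V\<close>
  replaces one factor \<open>q^n\<close>.\<close>

lemma card_aff_homs_diff_le:
  fixes B :: "(nat \<Rightarrow> 'a::{finite,field}) set"
  assumes B: "B \<subseteq> vecs m" and A: "A \<subseteq> vecs n" and xy: "x \<in> B" "y \<in> B" "x \<noteq> y"
    and V: "finite V"
  shows "card {\<phi> \<in> aff_homs m n B A. (\<lambda>i. \<phi> y i - \<phi> x i) \<in> V}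
    \<le> (card (UNIV :: 'a set) ^ n) ^ (rank_aff B - 1) * card V"
proof -
  let ?H = "{\<phi> \<in> aff_homs m n B A. (\<lambda>i. \<phi> y i - \<phi> x i) \<in> V}"
  have finB: "finite B" using B finite_vecs finite_subset by blast
  obtain S where S: "S \<subseteq> B" "aff_indep S" "card S = rank_aff B"
    and basis: "\<And>b. b \<in> B \<Longrightarrow> \<exists>a. sum a S = 1 \<and> b = lincomb a S"
    using exists_affine_basis[OF finB] by metis
  have finS: "finite S" using S by (simp add: aff_indep_def)
  obtain a where a: "sum a S = 1" "x = lincomb a S" using basis xy by blast
  obtain b where b: "sum b S = 1" "y = lincomb b S" using basis xy by blast
  \<comment> \<open>\<open>\<phi> y - \<phi> x\<close> is a nontrivial combination of the values of \<open>\<phi>\<close> on \<open>S\<close>, so it can replace one of them.\<close>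
  define \<mu> where "\<mu> = (\<lambda>s. b s - a s)"
  obtain s0 where s0: "s0 \<in> S" "\<mu> s0 \<noteq> 0"
  proof (rule ccontr)
    assume "\<not> thesis"
    then have "\<forall>s\<in>S. b s = a s" using that by (auto simp: \<mu>_def)
    then have "y = x" unfolding a b lincomb_def by (intro ext sum.cong) auto
    then show False using xy by simp
  qed
  have comb: "\<phi> y i - \<phi> x i = \<mu> s0 * \<phi> s0 i + (\<Sum>s\<in>S - {s0}. \<mu> s * \<phi> s i)"
    if "\<phi> \<in> ?H" for \<phi> i
  proof -
    have "\<phi> y i - \<phi> x i = (\<Sum>s\<in>S. \<mu> s * \<phi> s i)"
      using aff_homs_combination[OF _ B S(1), of \<phi> n A] that a b xy
      by (simp add: \<mu>_def sum_subtractf left_diff_distrib)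
    also have "\<dots> = \<mu> s0 * \<phi> s0 i + (\<Sum>s\<in>S - {s0}. \<mu> s * \<phi> s i)"
      using finS s0 by (simp add: sum.remove)
    finally show ?thesis .
  qed
  let ?g = "\<lambda>\<phi>. (restrict \<phi> (S - {s0}), \<lambda>i. \<phi> y i - \<phi> x i)"
  have inj: "inj_on ?g ?H"
  proof (rule inj_onI)
    fix \<phi> \<psi> assume *: "\<phi> \<in> ?H" "\<psi> \<in> ?H" "?g \<phi> = ?g \<psi>"
    have rest: "\<phi> s = \<psi> s" if "s \<in> S - {s0}" for s
      using fun_cong[OF arg_cong[OF *(3), of fst], of s] that by simp
    have "\<phi> s0 i = \<psi> s0 i" for i
    proof -
      have "\<phi> y i - \<phi> x i = \<psi> y i - \<psi> x i" 
        using fun_cong[OF arg_cong[OF *(3), of snd], of i] by simp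
      moreover have "(\<Sum>s\<in>S - {s0}. \<mu> s * \<phi> s i) = (\<Sum>s\<in>S - {s0}. \<mu> s * \<psi> s i)"
        using rest by (intro sum.cong) auto
      ultimately have "\<mu> s0 * \<phi> s0 i = \<mu> s0 * \<psi> s0 i"
        using comb[OF *(1), of i] comb[OF *(2), of i] by simp
      then show ?thesis using s0 by simp
    qed
    then show "\<phi> = \<psi>"
      using *(1,2) rest by (intro aff_homs_eqI[OF _ _ B S(1) basis, of \<phi> n A \<psi>]) auto
  qed
  have "?g \<phi> \<in> ((S - {s0}) \<rightarrow>\<^sub>E vecs n) \<times> V" if "\<phi> \<in> ?H" for \<phi>
    using that aff_homs_in_vecs[OF _ A, of \<phi> m B] S by auto
  then have "?g ` ?H \<subseteq> ((S - {s0}) \<rightarrow>\<^sub>E vecs n) \<times> V" by blast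
  moreover have "finite (((S - {s0}) \<rightarrow>\<^sub>E (vecs n :: (nat \<Rightarrow> 'a) set)) \<times> V)"
    using finS V by (intro finite_cartesian_product finite_PiE finite_vecs) auto
  ultimately have "card ?H \<le> card (((S - {s0}) \<rightarrow>\<^sub>E (vecs n :: (nat \<Rightarrow> 'a) set)) \<times> V)"
    using card_inj_on_le[OF inj] by blast
  also have "\<dots> = (card (UNIV :: 'a set) ^ n) ^ (rank_aff B - 1) * card V"
    using finS s0 S by (simp add: card_cartesian_product card_PiE card_vecs)
  finally show ?thesis .
qed


section \<open>One step: a dense set contains many translates of one linear image of
  \<open>B\<close>\<close>

text \<open>Pigeonhole, by summing the fibre sizes. Positivity of \<open>T\<close> and nonemptiness
  of \<open>Y\<close> make \<open>X\<close> nonempty, so the sum over fibres smaller than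
  \<open>T\<close> is strictly too small.\<close>

lemma exists_large_fibre:
  fixes T :: real
  assumes "finite X" "finite Y" "g ` X \<subseteq> Y" "0 < T" "Y \<noteq> {}" "card Y * T \<le> card X"
  obtains x where "x \<in> X" "T \<le> card {x' \<in> X. g x' = g x}"
proof (rule ccontr)
  assume "\<not> thesis"
  then have lt: "\<forall>x\<in>X. card {x' \<in> X. g x' = g x} < T"
    using that by (meson linorder_not_le)
  have "0 < card Y * T" using assms by (simp add: card_gt_0_iff)
  then have ne: "X \<noteq> {}" using assms(6) by auto
  have "real (card X) = (\<Sum>y\<in>g ` X. real (card {x' \<in> X. g x' = y}))"
    using sum.image_gen[OF assms(1), of "\<lambda>_. 1::real" g] by simp
  also have "\<dots> < (\<Sum>y\<in>g ` X. T)"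
    using lt ne assms(1) by (intro sum_strict_mono) auto
  also have "\<dots> = card (g ` X) * T" by simp
  also have "\<dots> \<le> card Y * T"
    using assms card_mono by (intro mult_right_mono) auto
  finally show False using assms by simp
qed

text \<open>The term \<open>card U * card V\<close> pays for the homomorphisms sending some direction in \<open>U\<close> into \<open>V\<close>.\<close>

lemma sidorenko_step:
  fixes B :: "(nat \<Rightarrow> 'a::{finite,field}) set" and V :: "(nat \<Rightarrow> 'a) set"
    and T :: real
  defines "q \<equiv> real (card (UNIV :: 'a set))"
  assumes B: "B \<subseteq> vecs m" "B \<noteq> {}" and sid: "weakly_sidorenko C m B"
    and U: "U \<subseteq> direction_set m B - {\<lambda>_. 0}"
    and A: "A \<subseteq> vecs n" and V: "finite V"
    and T: "T = (card A / q ^ n) powr C * q ^ n - card U * card V" "0 < T"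
  obtains M w A' where "A' \<subseteq> vecs n" "w \<in> vecs n" "T \<le> card A'"
    "\<And>y b. y \<in> A' \<Longrightarrow> b \<in> B \<Longrightarrow> (\<lambda>i. y i + (matvec n m M b i + w i)) \<in> A"
    "\<And>u. u \<in> U \<Longrightarrow> matvec n m M u \<notin> V"
proof -
  define N where "N = card (UNIV :: 'a set) ^ n"
  have qN: "q ^ n = N" by (simp add: q_def N_def)
  define H where "H = aff_homs m n B A"
  have finB: "finite B" using B finite_vecs finite_subset by blast
  have finU: "finite U"
    using finite_subset[OF _ finite_vecs[where 'a='a and n=m], of U] U
    by (auto simp: direction_set_def)
  have finA: "finite A" using A finite_vecs finite_subset by blast
  have finH: "finite H" unfolding H_def using finB finA by (rule finite_aff_homs)
  obtain S where S: "S \<subseteq> B" "aff_indep S" "card S = rank_aff B"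
    and basis: "\<And>b. b \<in> B \<Longrightarrow> \<exists>a. sum a S = 1 \<and> b = lincomb a S"
    using exists_affine_basis[OF finB] by metis
  have finS: "finite S" using S by (simp add: aff_indep_def)
  obtain b where "b \<in> B" using B by blast
  then have "S \<noteq> {}" using basis[of b] by auto
  then obtain b0 where b0: "b0 \<in> S" "b0 \<in> B" using S by blast
  define r where "r = card (S - {b0})"
  have r: "rank_aff B = Suc r" 
    using card_Suc_Diff1[OF finS b0(1)] S(3) by (simp only: r_def)
  \<comment> \<open>The parameters 0 and 1 on a line of \<open>B\<close> in direction
    \<open>d\<close> give two points of \<open>B\<close> that differ by \<open>d\<close>.\<close>
  have "\<exists>x. x \<in> B \<and> (\<lambda>i. x i + d i) \<in> B" if d: "d \<in> U" for d
  proof -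
    obtain x where "\<And>c. (\<lambda>i. x i + c * d i) \<in> B"
      using d U by (auto simp: direction_set_def)
    from this[of 0] this[of 1] show ?thesis by auto
  qed
  then obtain X where X: "\<And>d. d \<in> U \<Longrightarrow> X d \<in> B \<and> (\<lambda>i. X d i + d i) \<in> B" by metis
  \<comment> \<open>The homomorphisms whose linear part sends \<open>d\<close> into
    \<open>V\<close>, expressed through values at the two points \<open>X d\<close> and
    \<open>X d + d\<close> of \<open>B\<close>.\<close>
  define Bad where
    "Bad d = {\<phi> \<in> H. (\<lambda>i. \<phi> (\<lambda>j. X d j + d j) i - \<phi> (X d) i) \<in> V}" for d
  have Bad: "card (Bad d) \<le> N ^ r * card V" if d: "d \<in> U" for d
  proof -
    have "X d \<noteq> (\<lambda>j. X d j + d j)"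
      using U d by (auto simp: fun_eq_iff)
    from card_aff_homs_diff_le[OF B(1) A _ _ this V] X[OF d]
    show ?thesis by (simp add: Bad_def H_def N_def r)
  qed
  define Good where "Good = H - (\<Union>d\<in>U. Bad d)"
  have "card (\<Union>d\<in>U. Bad d) \<le> (\<Sum>d\<in>U. card (Bad d))" using finU by (rule card_UN_le)
  also have "\<dots> \<le> card U * (N ^ r * card V)"
    using sum_bounded_above[OF Bad] by simp
  finally have "real (card (\<Union>d\<in>U. Bad d)) \<le> real (card U * (N ^ r * card V))"
    by (rule of_nat_mono)
  moreover have "real (card H) \<le> card Good + card (\<Union>d\<in>U. Bad d)"
  proof -
    have "H \<subseteq> Good \<union> (\<Union>d\<in>U. Bad d)" by (auto simp: Good_def)
    moreover have "finite (Good \<union> (\<Union>d\<in>U. Bad d))"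
      using finH finU by (auto simp: Good_def Bad_def)
    ultimately have "card H \<le> card (Good \<union> (\<Union>d\<in>U. Bad d))" by (rule card_mono[rotated])
    also have "\<dots> \<le> card Good + card (\<Union>d\<in>U. Bad d)" by (rule card_Un_le)
    finally show ?thesis by linarith
  qed
  moreover have "(card A / q ^ n) powr C * (q ^ n) ^ Suc r \<le> card H"
    using sid A r by (simp add: weakly_sidorenko_def hom_aff_eq_card H_def q_def)
  \<comment> \<open>The Sidorenko bound has \<open>r + 1\<close> factors \<open>N\<close>. One of
    them stays in \<open>T\<close>, and the other \<open>r\<close> match the number of possible
    translation classes.\<close>
  ultimately have large: "N ^ r * T \<le> card Good"
    unfolding T qN by (simp add: algebra_simps)
  define Y where "Y = (S - {b0}) \<rightarrow>\<^sub>E (vecs n :: (nat \<Rightarrow> 'a) set)"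
  have cardY: "card Y = N ^ r"
    using finS by (simp add: Y_def card_PiE card_vecs N_def r_def)
  have finY: "finite Y" unfolding Y_def using finS by (intro finite_PiE finite_vecs) auto
  have "Y \<noteq> {}" using zero_in_vecs by (auto simp: Y_def PiE_eq_empty_iff)
  \<comment> \<open>The differences to the value at \<open>b0\<close> record \<open>\<phi>\<close>
    up to translation.\<close>
  define g where "g \<phi> = restrict (\<lambda>s i. \<phi> s i - \<phi> b0 i) (S - {b0})"
    for \<phi> :: "(nat \<Rightarrow> 'a) \<Rightarrow> (nat \<Rightarrow> 'a)"
  have "g \<phi> \<in> Y" if "\<phi> \<in> Good" for \<phi>
  proof -
    have "\<phi> x \<in> vecs n" if "x \<in> B" for x
      using aff_homs_in_vecs[OF _ A that, of \<phi> m] \<open>\<phi> \<in> Good\<close> by (simp add: Good_def H_def)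
    then have "(\<lambda>i. \<phi> s i - \<phi> b0 i) \<in> vecs n" if "s \<in> S" for s
      using b0 S that by (auto simp: vecs_def)
    then show ?thesis by (auto simp: g_def Y_def)
  qed
  then have "g ` Good \<subseteq> Y" by blast
  moreover have "finite Good" using finH by (simp add: Good_def)
  ultimately obtain \<phi>0 where \<phi>0: "\<phi>0 \<in> Good" "T \<le> card {\<phi> \<in> Good. g \<phi> = g \<phi>0}"
    using exists_large_fibre[of Good Y g T] finY \<open>0 < T\<close> \<open>Y \<noteq> {}\<close> large cardY by auto
  define F where "F = {\<phi> \<in> Good. g \<phi> = g \<phi>0}"
  have F_homs: "\<phi> \<in> aff_homs m n B A" if "\<phi> \<in> F" for \<phi>
    using that by (simp add: F_def Good_def H_def)
  have shift_S: "\<phi> s i = \<phi>0 s i + (\<phi> b0 i - \<phi>0 b0 i)" if "\<phi> \<in> F" "s \<in> S" for \<phi> s i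
  proof (cases "s = b0")
    case False
    have "g \<phi> s i = g \<phi>0 s i" using that by (simp add: F_def)
    then show ?thesis using that False by (simp add: g_def algebra_simps)
  qed simp
  have "\<phi>0 \<in> F" using \<phi>0 by (simp add: F_def)
  \<comment> \<open>Within a fibre of \<open>g\<close> any two homomorphisms differ by a
    translation, first on the basis \<open>S\<close> and then, by affine combination, on all of
    \<open>B\<close>. Hence the value at \<open>b0\<close> determines \<open>\<phi>\<close>, and
    \<open>A'\<close> is as large as the fibre.\<close>
  have shift: "\<phi> b i = \<phi> b0 i + (\<phi>0 b i - \<phi>0 b0 i)" if \<phi>: "\<phi> \<in> F" and b: "b \<in> B" for \<phi> b i
  proof -
    obtain a where a: "sum a S = 1" "b = lincomb a S" using basis[OF b] by blast
    have comb: "\<psi> b i = (\<Sum>s\<in>S. a s * \<psi> s i)" if "\<psi> \<in> F" for \<psi>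
      using aff_homs_combination[OF F_homs[OF that] B(1) S(1)] a \<open>b \<in> B\<close> by simp
    have "\<phi> b i = (\<Sum>s\<in>S. a s * \<phi>0 s i + a s * (\<phi> b0 i - \<phi>0 b0 i))"
      unfolding comb[OF \<phi>] using shift_S[OF \<phi>]
      by (intro sum.cong) (simp_all add: distrib_left)
    also have "\<dots> = \<phi>0 b i + sum a S * (\<phi> b0 i - \<phi>0 b0 i)"
      by (simp add: sum.distrib comb[OF \<open>\<phi>0 \<in> F\<close>] sum_distrib_right)
    finally show ?thesis using a by simp
  qed
  define A' where "A' = (\<lambda>\<phi>. \<phi> b0) ` F"
  have "inj_on (\<lambda>\<phi>. \<phi> b0) F"
  proof (rule inj_onI)
    fix \<phi> \<psi> assume *: "\<phi> \<in> F" "\<psi> \<in> F" "\<phi> b0 = \<psi> b0"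
    have "\<phi> s = \<psi> s" if "s \<in> S" for s
      using shift_S[OF *(1) that] shift_S[OF *(2) that] *(3) by (simp add: fun_eq_iff)
    then show "\<phi> = \<psi>"
      using aff_homs_eqI[OF F_homs[OF *(1)] F_homs[OF *(2)] B(1) S(1) basis] by simp
  qed
  then have "T \<le> card A'" using \<phi>0(2) by (simp add: A'_def card_image F_def)
  obtain M w where Mw: "w \<in> vecs n" "\<And>x. x \<in> B \<Longrightarrow> \<phi>0 x = (\<lambda>i. matvec n m M x i + w i)"
    using aff_homsE[OF F_homs[OF \<open>\<phi>0 \<in> F\<close>] B(1)] by blast
  \<comment> \<open>The shift passed on is minus the linear image of \<open>b0\<close>, not the
    translation part of \<open>\<phi>0\<close>: the elements of \<open>A'\<close> are values at
    \<open>b0\<close>, so the image of \<open>b\<close> is displaced from them by the linear image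
    of \<open>b - b0\<close>.\<close>
  show thesis
  proof (rule that)
    show "A' \<subseteq> vecs n"
      using aff_homs_in_vecs[OF F_homs A b0(2)] by (auto simp: A'_def)
    show "(\<lambda>i. - matvec n m M b0 i) \<in> vecs n"
      using matvec_in_vecs[of n m M b0] by (simp add: vecs_def)
    show "T \<le> card A'" by fact
    show "(\<lambda>i. y i + (matvec n m M b i + - matvec n m M b0 i)) \<in> A"
      if y: "y \<in> A'" and b: "b \<in> B" for y b
    proof -
      obtain \<phi> where \<phi>: "\<phi> \<in> F" "y = \<phi> b0" using y by (auto simp: A'_def)
      have "\<phi> b = (\<lambda>i. y i + (matvec n m M b i + - matvec n m M b0 i))"
        using shift[OF \<phi>(1) b] Mw(2)[OF b] Mw(2)[OF b0(2)] \<phi>(2) by (simp add: fun_eq_iff)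
      moreover have "\<phi> b \<in> A" using F_homs[OF \<phi>(1)] b by (auto simp: aff_homs_def)
      ultimately show ?thesis by simp
    qed
    show "matvec n m M u \<notin> V" if u: "u \<in> U" for u
    proof
      assume "matvec n m M u \<in> V"
      moreover have "(\<lambda>i. \<phi>0 (\<lambda>j. X u j + u j) i - \<phi>0 (X u) i) = matvec n m M u"
        using Mw(2) X[OF u] matvec_add[of n m M "X u" 1 u] by (simp add: fun_eq_iff)
      ultimately have "\<phi>0 \<in> Bad u"
        using \<phi>0 by (auto simp: Bad_def Good_def)
      then show False using \<phi>0 u by (auto simp: Good_def)
    qed
  qed
qed


section \<open>Iterating the step to a large space of directions; the exponent is at least 2\<close>

lemma lin_indep_zero_notin: "lin_indep S \<Longrightarrow> (\<lambda>_. 0) \<notin> S"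
proof
  assume S: "lin_indep S" "(\<lambda>_. 0) \<in> S"
  let ?c = "\<lambda>x. if x = (\<lambda>_. 0) then 1 else (0::'a)"
  have "lincomb ?c S = (\<lambda>_. 0)" by (auto simp: lincomb_def fun_eq_iff intro!: sum.neutral)
  moreover have "?c (\<lambda>_. 0) \<noteq> 0" by simp
  ultimately show False using S unfolding lin_indep_def by blast
qed

lemma lspan_empty: "lspan {} = {\<lambda>_. 0}"
  by (auto simp: lspan_def lincomb_def)

text \<open>By \<open>nd\<close>, \<open>L\<close> induces an injective map from
  \<open>lspan E\<close> into the quotient by \<open>lspan D\<close>, so the dimensions add up. The
  last conclusion splits a vector of the new space into an old direction and an image of a direction
  of \<open>B\<close>.\<close>

lemma lin_indep_Un_matvec_image:
  fixes M :: "nat \<Rightarrow> nat \<Rightarrow> 'a::field" and n m :: nat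
  defines "L \<equiv> matvec n m M"
  assumes D: "lin_indep D" and E: "lin_indep E"
    and nd: "\<And>u. u \<in> lspan E \<Longrightarrow> u \<noteq> (\<lambda>_. 0) \<Longrightarrow> L u \<notin> lspan D"
  shows "lin_indep (D \<union> L ` E)" "card (D \<union> L ` E) = card D + card E"
    "\<And>w. w \<in> lspan (D \<union> L ` E) \<Longrightarrow>
      \<exists>v\<in>lspan D. \<exists>u\<in>lspan E. w = (\<lambda>i. v i + L u i)"
proof -
  have fin: "finite D" "finite E" using D E by (auto simp: lin_indep_def)
  have inj: "inj_on L E"
  proof (rule inj_onI, rule ccontr)
    fix e e' assume e: "e \<in> E" "e' \<in> E" "L e = L e'" "e \<noteq> e'"
    have "(\<lambda>i. e i + (-1) * e' i) \<in> lspan E"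
      using e in_lspan[OF fin(2)] by (intro lspan_add) auto
    moreover have "(\<lambda>i. e i + (-1) * e' i) \<noteq> (\<lambda>_. 0)" using e by (auto simp: fun_eq_iff)
    ultimately have "L (\<lambda>i. e i + (-1) * e' i) \<notin> lspan D" by (rule nd)
    then show False
      unfolding L_def matvec_add using e zero_in_lspan[of D] by (simp add: L_def)
  qed
  have disj: "D \<inter> L ` E = {}"
    using nd in_lspan[OF fin(1)] in_lspan[OF fin(2)] lin_indep_zero_notin[OF E] by fastforce
  have split: "lincomb c (D \<union> L ` E) = (\<lambda>i. lincomb c D i + L (lincomb (\<lambda>e. c (L e)) E) i)" for c
  proof
    fix i
    have "lincomb c (D \<union> L ` E) i = lincomb c D i + (\<Sum>x\<in>L ` E. c x * x i)"
      unfolding lincomb_def using fin disj by (intro sum.union_disjoint) auto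
    also have "(\<Sum>x\<in>L ` E. c x * x i) = L (lincomb (\<lambda>e. c (L e)) E) i"
      using inj by (simp add: L_def matvec_lincomb sum.reindex)
    finally show "lincomb c (D \<union> L ` E) i = lincomb c D i + L (lincomb (\<lambda>e. c (L e)) E) i" .
  qed
  have "c x = 0" if c: "lincomb c (D \<union> L ` E) = (\<lambda>_. 0)" and x: "x \<in> D \<union> L ` E" for c x
  proof -
    define u where "u = lincomb (\<lambda>e. c (L e)) E"
    have eq: "L u i = (-1) * lincomb c D i" for i
      using fun_cong[OF c, of i] by (simp add: split u_def add_eq_0_iff)
    then have "L u \<in> lspan D"
      using lspan_scale[OF lincomb_in_lspan, of "-1" c D] by presburger
    moreover have "u \<in> lspan E" by (simp add: u_def lincomb_in_lspan)
    ultimately have u0: "u = (\<lambda>_. 0)" using nd by blast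
    then have "\<forall>e\<in>E. c (L e) = 0" using E unfolding u_def lin_indep_def by blast
    moreover have "lincomb c D = (\<lambda>_. 0)"
      using eq unfolding u0 by (simp add: L_def matvec_zero fun_eq_iff)
    then have "\<forall>d\<in>D. c d = 0" using D unfolding lin_indep_def by blast
    ultimately show ?thesis using x by blast
  qed
  then show "lin_indep (D \<union> L ` E)" using fin unfolding lin_indep_def by blast
  show "card (D \<union> L ` E) = card D + card E"
    using fin disj inj by (simp add: card_Un_disjoint card_image)
  show "\<exists>v\<in>lspan D. \<exists>u\<in>lspan E. w = (\<lambda>i. v i + L u i)" if w: "w \<in> lspan (D \<union> L ` E)" for w
  proof -
    obtain c where "w = lincomb c (D \<union> L ` E)" using w by (auto simp: lspan_def)
    then show ?thesis using split lincomb_in_lspan by blast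
  qed
qed

text \<open>Tracking half the density absorbs the factor 2 lost in each step, because \<open>2^C \<ge> 4\<close>.\<close>

lemma sidorenko_iterate:
  fixes B :: "(nat \<Rightarrow> 'a::{finite,field}) set" and A :: "(nat \<Rightarrow> 'a) set" and \<gamma> :: real
  defines "q \<equiv> real (card (UNIV :: 'a set))"
  assumes B: "B \<subseteq> vecs m" "B \<noteq> {}" and sid: "weakly_sidorenko C m B"
    and E: "lin_indep E" "card E = p" "lspan E \<subseteq> direction_set m B \<union> {\<lambda>_. 0}"
    and A: "A \<subseteq> vecs n" and C: "2 \<le> C"
    and \<gamma>: "0 < \<gamma>" "\<gamma> \<le> 1" "2 * \<gamma> \<le> card A / q ^ n"
  shows "q ^ (p * k) \<le> q ^ n * \<gamma> powr (C ^ k) \<Longrightarrow>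
    \<exists>D A'. D \<subseteq> vecs n \<and> lin_indep D \<and> card D = p * k \<and> A' \<subseteq> vecs n \<and>
      2 * \<gamma> powr (C ^ k) \<le> card A' / q ^ n \<and>
      (\<forall>d\<in>lspan D. \<exists>x. \<forall>y\<in>A'. \<forall>c. (\<lambda>i. y i + (x i + c * d i)) \<in> A)"
proof (induction k)
  case 0
  show ?case
    using A \<gamma> by (intro exI[of _ "{}"] exI[of _ A])
      (auto simp: lin_indep_def lspan_empty intro!: exI[of _ "\<lambda>_. 0"])
next
  case (Suc k)
  have q: "2 \<le> q" using two_le_card_field[where 'a='a] by (simp add: q_def)
  \<comment> \<open>The size hypothesis passes down from \<open>Suc k\<close> to \<open>k\<close>:
    the left side shrinks, and the right side grows since \<open>\<gamma> \<le> 1\<close> and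
    \<open>C \<ge> 2\<close>.\<close>
  have "q ^ (p * k) \<le> q ^ (p * Suc k)" using q by (intro power_increasing) auto
  also have "\<dots> \<le> q ^ n * \<gamma> powr (C ^ Suc k)" using Suc.prems .
  also have "\<dots> \<le> q ^ n * \<gamma> powr (C ^ k)"
    using q C \<gamma> by (intro mult_left_mono powr_mono' power_increasing) auto
  finally obtain D A' where D: "D \<subseteq> vecs n" "lin_indep D" "card D = p * k"
    and A': "A' \<subseteq> vecs n" "2 * \<gamma> powr (C ^ k) \<le> card A' / q ^ n"
    and dir: "\<And>d. d \<in> lspan D \<Longrightarrow> \<exists>x. \<forall>y\<in>A'. \<forall>c. (\<lambda>i. y i + (x i + c * d i)) \<in> A"
    using Suc.IH by blast
  have fin: "finite D" "finite E" using D E by (auto simp: lin_indep_def)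
  \<comment> \<open>For the dimension to grow by \<open>p\<close>, no nonzero vector of
    \<open>lspan E\<close> may be mapped into \<open>lspan D\<close>. The resulting loss is at most
    \<open>q^p * q^(p * k)\<close>, which the size hypothesis bounds by
    \<open>q^n * \<delta>\<close>.\<close>
  define U where "U = lspan E - {\<lambda>_. 0}"
  define T where
    "T = (card A' / q ^ n) powr C * q ^ n - card U * card (lspan D)"
  define \<delta> where "\<delta> = \<gamma> powr (C ^ Suc k)"
  have "card U \<le> card (lspan E)"
    unfolding U_def using card_lspan_le[OF fin(2)] by (intro card_mono) auto
  also have "\<dots> \<le> card (UNIV :: 'a set) ^ p" using card_lspan_le[OF fin(2)] E by simp
  finally have "card U * card (lspan D) \<le> card (UNIV :: 'a set) ^ p * card (UNIV :: 'a set) ^ (p * k)"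
    using card_lspan_le[OF fin(1)] D by (intro mult_mono) auto
  then have "real (card U * card (lspan D)) \<le> real (card (UNIV :: 'a set) ^ (p * Suc k))"
    unfolding of_nat_le_iff by (simp add: power_add)
  also have "\<dots> \<le> q ^ n * \<delta>" using Suc.prems by (simp add: q_def \<delta>_def)
  finally have UD: "real (card U * card (lspan D)) \<le> q ^ n * \<delta>" .
  have "4 * \<delta> = 2 powr 2 * \<delta>" by simp
  also have "\<dots> \<le> 2 powr C * \<delta>"
    using C by (intro mult_right_mono powr_mono) (auto simp: \<delta>_def)
  also have "\<dots> = (2 * \<gamma> powr (C ^ k)) powr C"
    by (simp add: powr_mult powr_powr \<delta>_def mult.commute)
  also have "\<dots> \<le> (card A' / q ^ n) powr C"
    using A' C by (intro powr_mono2) auto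
  finally have "4 * \<delta> * q ^ n \<le> (card A' / q ^ n) powr C * q ^ n"
    using q by (intro mult_right_mono) auto
  moreover have "0 < \<delta> * q ^ n" using \<gamma> q by (simp add: \<delta>_def)
  \<comment> \<open>At most one of the four units \<open>\<delta> * q^n\<close> is lost to excluded
    homomorphisms, and two suffice to continue.\<close>
  ultimately have T: "2 * \<delta> * q ^ n \<le> T" "0 < T" using UD by (auto simp: T_def algebra_simps)
  have U: "U \<subseteq> direction_set m B - {\<lambda>_. 0}" using E by (auto simp: U_def)
  obtain M w A'' where A'': "A'' \<subseteq> vecs n" "w \<in> vecs n" "T \<le> card A''"
    and step: "\<And>y b. y \<in> A'' \<Longrightarrow> b \<in> B \<Longrightarrow> (\<lambda>i. y i + (matvec n m M b i + w i)) \<in> A'"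
    and nd: "\<And>u. u \<in> U \<Longrightarrow> matvec n m M u \<notin> lspan D"
    by (rule sidorenko_step[OF B sid U A'(1) card_lspan_le(1)[OF fin(1)]
        T_def[unfolded q_def] T(2)]) (rule that)
  have nd': "matvec n m M u \<notin> lspan D" if "u \<in> lspan E" "u \<noteq> (\<lambda>_. 0)" for u
    using nd that by (auto simp: U_def)
  define D' where "D' = D \<union> matvec n m M ` E"
  have D': "lin_indep D'" "card D' = card D + card E"
    "\<And>d. d \<in> lspan D' \<Longrightarrow>
      \<exists>v\<in>lspan D. \<exists>u\<in>lspan E. d = (\<lambda>i. v i + matvec n m M u i)"
    unfolding D'_def using lin_indep_Un_matvec_image[OF D(2) E(1) nd'] by auto
  have "D' \<subseteq> vecs n" using D matvec_in_vecs by (auto simp: D'_def)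
  moreover have "card D' = p * Suc k" using D' D E by simp
  moreover have "2 * \<gamma> powr (C ^ Suc k) \<le> card A'' / q ^ n"
    using T(1) A''(3) q by (simp add: \<delta>_def field_simps)
  moreover have "\<exists>x. \<forall>y\<in>A''. \<forall>c. (\<lambda>i. y i + (x i + c * d i)) \<in> A" if d: "d \<in> lspan D'" for d
  proof -
    obtain v u where v: "v \<in> lspan D" and u: "u \<in> lspan E"
      and duv: "d = (\<lambda>i. v i + matvec n m M u i)"
      using D'(3)[OF d] by blast
    obtain x where x: "\<And>y c. y \<in> A' \<Longrightarrow> (\<lambda>i. y i + (x i + c * v i)) \<in> A"
      using dir[OF v] by blast
    \<comment> \<open>For \<open>u = 0\<close> the line degenerates to a point, and any point of
      \<open>B\<close> serves.\<close>
    have "\<exists>z. \<forall>c. (\<lambda>i. z i + c * u i) \<in> B"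
    proof (cases "u = (\<lambda>_. 0)")
      case True
      then show ?thesis using B by auto
    next
      case False
      then show ?thesis using u E by (auto simp: direction_set_def)
    qed
    then obtain z where z: "\<And>c. (\<lambda>i. z i + c * u i) \<in> B" by blast
    \<comment> \<open>For each \<open>c\<close> the point \<open>z + c u\<close> of \<open>B\<close>
      moves \<open>y\<close> into \<open>A'\<close>, and from there the old shift
      \<open>x + c v\<close> with the same \<open>c\<close> leads into \<open>A\<close>. The old
      \<open>x\<close> does not depend on the point of \<open>A'\<close>, so the two displacements
      add up to a line in direction \<open>d\<close>.\<close>
    have "(\<lambda>i. y i + ((matvec n m M z i + w i + x i) + c * d i)) \<in> A" if y: "y \<in> A''" for y c
    proof -
      have "(\<lambda>i. (y i + (matvec n m M (\<lambda>i. z i + c * u i) i + w i)) + (x i + c * v i)) \<in> A"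
        using x[OF step[OF y z]] .
      then show ?thesis unfolding matvec_add duv by (simp add: algebra_simps)
    qed
    then show ?thesis by (intro exI[of _ "\<lambda>i. matvec n m M z i + w i + x i"]) blast
  qed
  ultimately show ?case using D'(1) A''(1) by blast
qed

text \<open>Test the Sidorenko inequality on a single point of \<open>F_q^1\<close>.\<close>

lemma weakly_sidorenko_ge_2:
  fixes B :: "(nat \<Rightarrow> 'a::{finite,field}) set"
  assumes B: "B \<subseteq> vecs m" and sid: "weakly_sidorenko C m B"
    and xy: "x \<in> B" "y \<in> B" "x \<noteq> y"
  shows "2 \<le> C"
proof -
  define q where "q = real (card (UNIV :: 'a set))"
  have q: "2 \<le> q" using two_le_card_field[where 'a='a] by (simp add: q_def)
  have finB: "finite B" using B finite_vecs finite_subset by blast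
  let ?Z = "{\<lambda>_. 0} :: (nat \<Rightarrow> 'a) set"
  have "aff_indep {x, y}"
  proof -
    have "c z = 0" if c: "sum c {x, y} = 0" "lincomb c {x, y} = (\<lambda>_. 0)" "z \<in> {x, y}" for c z
    proof -
      have cy: "c y = - c x" using c(1) xy by (simp add: add_eq_0_iff)
      obtain i where i: "x i \<noteq> y i" using xy by auto
      have "c x * x i + c y * y i = 0"
        using fun_cong[OF c(2), of i] xy by (simp add: lincomb_def)
      then have "c x * (x i - y i) = 0" unfolding cy by (simp add: algebra_simps)
      then show ?thesis using i cy c(3) by auto
    qed
    then show ?thesis unfolding aff_indep_def by blast
  qed
  then have "card {x, y} \<in> {card S | S. S \<subseteq> B \<and> aff_indep S}" using xy by blast
  moreover have "finite {card S | S. S \<subseteq> B \<and> aff_indep S}"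
    by (rule finite_subset[of _ "{..card B}"]) (auto intro: card_mono[OF finB])
  ultimately have "card {x, y} \<le> rank_aff B" unfolding rank_aff_def by (rule Max_ge[rotated])
  then have r: "2 \<le> rank_aff B" using xy by simp
  \<comment> \<open>There is only one map into a point, and the point has density
    \<open>1 / q\<close>; the inequality then forces \<open>rank_aff B \<le> C\<close>, while two
    distinct points make the rank at least 2.\<close>
  have "hom_aff m 1 B ?Z \<le> card (B \<rightarrow>\<^sub>E ?Z)"
    unfolding hom_aff_eq_card 
    using finB by (intro card_mono aff_homs_subset_PiE) (auto intro: finite_PiE)
  also have "\<dots> = 1" using finB by (simp add: card_PiE)
  finally have "real (hom_aff m 1 B ?Z) \<le> 1" by simp
  moreover have "?Z \<subseteq> vecs 1" by (simp add: zero_in_vecs)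
  then have "(1 / q) powr C * q ^ rank_aff B \<le> hom_aff m 1 B ?Z"
    using sid[unfolded weakly_sidorenko_def, rule_format, of ?Z 1] by (simp add: q_def)
  ultimately have "(1 / q) powr C * q ^ rank_aff B \<le> 1" by linarith
  then have "q ^ rank_aff B \<le> q powr C" using q by (simp add: powr_divide field_simps)
  then have "q powr rank_aff B \<le> q powr C" using q by (simp add: powr_realpow)
  then have "rank_aff B \<le> C" using q by simp
  then show ?thesis using r by linarith
qed

section \<open>From spaces of directions to the Ramsey bound\<close>

text \<open>The condition on \<open>n\<close> is the logarithm to base \<open>q\<close> of the size
  hypothesis of \<open>sidorenko_iterate\<close> at \<open>\<gamma> = q powr (- (t + 1))\<close>.
  The case distinction is whether the red vectors are sparse enough for the greedy choice.\<close>

lemma ramsey_q_le: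
  fixes B :: "(nat \<Rightarrow> 'a::{finite,field}) set"
  assumes B: "B \<subseteq> vecs m" "B \<noteq> {}" and sid: "weakly_sidorenko C m B"
    and E: "lin_indep E" "card E = p" "lspan E \<subseteq> direction_set m B \<union> {\<lambda>_. 0}"
    and C: "2 \<le> C"
    and t: "t \<le> p * k" and n: "real (p * k) + (real t + 1) * C ^ k \<le> n"
  shows "ramsey_q TYPE('a) 2 t \<le> n"
  unfolding ramsey_q_def
proof (rule Least_le, rule allI)
  fix col :: "(nat \<Rightarrow> 'a) set \<Rightarrow> bool"
  define q where "q = real (card (UNIV :: 'a set))"
  have q: "2 \<le> q" using two_le_card_field[where 'a='a] by (simp add: q_def)
  define X where "X = {v \<in> vecs n. v \<noteq> (\<lambda>_. 0) \<and> col (lspan {v})}"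
  have X: "X \<subseteq> vecs n" "(\<lambda>_. 0) \<notin> X" by (auto simp: X_def)
  have scale: "(\<lambda>i. c * v i) \<in> X" if "c \<noteq> 0" "v \<in> X" for c v
    using that by (auto simp: X_def lspan_singleton_scale vecs_def fun_eq_iff)
  show "(\<exists>W\<in>subspaces_dim n 2. \<forall>v\<in>W - {\<lambda>_. 0}. col (lspan {v})) \<or>
    (\<exists>W\<in>subspaces_dim n t. \<forall>v\<in>W - {\<lambda>_. 0}. \<not> col (lspan {v}))"
  proof (cases "card (UNIV :: 'a set) ^ t * (card X + 1) \<le> card (UNIV :: 'a set) ^ n")
    case True
    obtain S where S: "S \<subseteq> vecs n" "lin_indep S" "card S = t" "lspan S \<inter> X = {}"
      using exists_subspace_avoiding[OF X scale True order.refl] by blast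
    then have "lspan S \<in> subspaces_dim n t" by (auto simp: subspaces_dim_def)
    moreover have "\<not> col (lspan {v})" if "v \<in> lspan S - {\<lambda>_. 0}" for v
      using that S lspan_subset_vecs[OF S(1)] by (auto simp: X_def)
    ultimately show ?thesis by blast
  next
    case False
    have "1 \<le> C ^ k" using C by simp
    \<comment> \<open>Needed for \<open>n - t\<close> to be a true difference.\<close>
    then have "real t \<le> n" using t n
      by (smt (verit) mult_left_mono mult_cancel_left2 of_nat_0_le_iff)
    then have tn: "n = t + (n - t)" by simp
    have "card (UNIV :: 'a set) ^ t * card (UNIV :: 'a set) ^ (n - t)
        < card (UNIV :: 'a set) ^ t * (card X + 1)"
      using False unfolding power_add[symmetric] tn[symmetric] by simp
    then have "card (UNIV :: 'a set) ^ (n - t) < card X + 1"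
      by (rule mult_left_less_imp_less) simp
    then have "card (UNIV :: 'a set) ^ (n - t) \<le> card X" by simp
    then have "real (card (UNIV :: 'a set) ^ (n - t)) \<le> real (card X)" by (rule of_nat_mono)
    then have dens: "q ^ (n - t) \<le> card X" by (simp add: q_def)
    \<comment> \<open>The red vectors have density at least \<open>q powr (- t)\<close>. The extra
      factor \<open>1 / q\<close> pays for the 2 in \<open>2 * \<gamma>\<close>, as
      \<open>q \<ge> 2\<close>.\<close>
    define \<gamma> where "\<gamma> = q powr (- (real t + 1))"
    have \<gamma>: "0 < \<gamma>" "\<gamma> \<le> 1" using q powr_mono[of "- (real t + 1)" 0 q] by (auto simp: \<gamma>_def)
    have "2 * \<gamma> \<le> q * \<gamma>" using q \<gamma> by simp
    also have "\<dots> = q powr (- real t)"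
      using q by (simp add: \<gamma>_def powr_mult_base)
    also have "\<dots> = q ^ (n - t) / q ^ n"
      using q by (subst tn) (simp add: power_add powr_minus powr_realpow field_simps)
    also have "\<dots> \<le> card X / q ^ n" using dens q by (intro divide_right_mono) auto
    finally have \<gamma>X: "2 * \<gamma> \<le> card X / q ^ n" .
    have "q ^ (p * k) = q powr real (p * k)" using q by (simp only: powr_realpow)
    also have "\<dots> \<le> q powr (n + - (real t + 1) * C ^ k)" 
      using n q by (intro powr_mono) (auto simp: algebra_simps)
    also have "\<dots> = q ^ n * \<gamma> powr (C ^ k)"
      using q by (simp add: powr_add powr_powr \<gamma>_def powr_realpow)
    finally obtain D A' where D: "D \<subseteq> vecs n" "lin_indep D" "card D = p * k"
      and A': "2 * \<gamma> powr (C ^ k) \<le> card A' / q ^ n"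
      and dir: "\<And>d. d \<in> lspan D \<Longrightarrow> \<exists>x. \<forall>y\<in>A'. \<forall>c. (\<lambda>i. y i + (x i + c * d i)) \<in> X"
      using sidorenko_iterate[OF B sid E X(1) C \<gamma>(1,2) \<gamma>X[unfolded q_def], of k]
      unfolding q_def by blast
    have "0 < \<gamma> powr (C ^ k)" using \<gamma> by simp
    \<comment> \<open>A single point \<open>y\<close> of \<open>A'\<close> is enough: it leads to a
      line inside \<open>X\<close> in every direction of \<open>lspan D\<close>.\<close>
    then have "A' \<noteq> {}" using A' by auto
    then obtain y where y: "y \<in> A'" by blast
    obtain S where S: "S \<subseteq> D" "card S = t" using t D obtain_subset_with_card_n by metis
    have finD: "finite D" using D by (simp add: lin_indep_def)
    show ?thesis
    proof (cases "\<exists>v\<in>lspan S - {\<lambda>_. 0}. col (lspan {v})")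
      case False
      moreover have "lspan S \<in> subspaces_dim n t"
        using S D lin_indep_mono[OF D(2) S(1)] by (auto simp: subspaces_dim_def)
      ultimately show ?thesis by blast
    next
      \<comment> \<open>A red \<open>v\<close> in \<open>lspan S\<close> is the direction of a line
        \<open>z + c v\<close> of red vectors. Up to scaling, every nonzero vector in the span of
        \<open>z\<close> and \<open>v\<close> is \<open>v\<close> or a point of this line, so the
        plane is red.\<close>
      case True
      then obtain v where v: "v \<in> lspan S" "v \<noteq> (\<lambda>_. 0)" "col (lspan {v})" by blast
      have vD: "v \<in> lspan D" using v lspan_mono[OF finD S(1)] by blast
      then have vX: "v \<in> X" using v lspan_subset_vecs[OF D(1)] by (auto simp: X_def)
      obtain x where x: "\<And>c. (\<lambda>i. y i + (x i + c * v i)) \<in> X" using dir[OF vD] y by blast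
      define z where "z = (\<lambda>i. y i + x i)"
      have z: "(\<lambda>i. z i + c * v i) \<in> X" for c
        using x[of c] by (simp add: z_def add.assoc)
      have zX: "z \<in> X" using z[of 0] by simp
      \<comment> \<open>Otherwise the line would pass through 0, which is not in
        \<open>X\<close>.\<close>
      have z_notin: "z \<notin> lspan {v}"
      proof
        assume "z \<in> lspan {v}"
        then obtain c where "z = (\<lambda>i. c * v i)" by (auto simp: lspan_singleton)
        then show False using z[of "- c"] X by simp
      qed
      have "lin_indep {v}"
        using v by (intro lin_indep_insert) (auto simp: lin_indep_def lspan_empty)
      then have "lin_indep {z, v}" using z_notin by (rule lin_indep_insert)
      moreover have "z \<noteq> v" using z_notin in_lspan[of "{v}" v] by auto
      ultimately have "lspan {z, v} \<in> subspaces_dim n 2"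
        using zX vX X by (auto simp: subspaces_dim_def intro!: exI[of _ "{z, v}"])
      moreover have "col (lspan {w})" if w: "w \<in> lspan {z, v} - {\<lambda>_. 0}" for w
      proof -
        have "finite {v}" "w \<in> lspan {z, v}" using w by auto
        then obtain c u where "u \<in> lspan {v}" and wu: "w = (\<lambda>i. c * z i + u i)"
          by (rule lspan_insertE) (rule that)
        then obtain b where u: "u = (\<lambda>i. b * v i)" by (auto simp: lspan_singleton)
        have "w \<in> X"
        proof (cases "c = 0")
          case True
          then have "b \<noteq> 0" using w wu u by auto
          then show ?thesis using True scale vX wu u by simp
        next
          case False
          have w_eq: "w = (\<lambda>i. c * (z i + b / c * v i))"
            using False by (simp add: wu u fun_eq_iff field_simps)
          show ?thesis unfolding w_eq by (rule scale[OF False z])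
        qed
        then show ?thesis by (simp add: X_def)
      qed
      ultimately show ?thesis by blast
    qed
  qed
qed

theorem theorem6p3:
  fixes B :: "(nat \<Rightarrow> 'a::{finite,field}) set" and m :: nat and C :: real
  assumes "B \<subseteq> vecs m"
    and "weakly_sidorenko C m B"
    and "omega_dir m B \<ge> 1"
  shows "(\<lambda>t. real (ramsey_q TYPE('a) 2 t))
           \<in> O(\<lambda>t. real t * C powr (real t / real (omega_dir m B)))"
proof -
  define p where "p = omega_dir m B"
  have p: "1 \<le> p" using assms(3) by (simp add: p_def)
  let ?K = "{k. \<exists>V\<in>subspaces_dim m k. V \<subseteq> direction_set m B \<union> {\<lambda>_. 0}}"
  \<comment> \<open>For \<open>Max\<close> to be attained the set of dimensions must be finite and
    nonempty: a basis inside \<open>vecs m\<close> bounds them, and 0 occurs.\<close>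
  have "?K \<subseteq> {..card (vecs m :: (nat \<Rightarrow> 'a) set)}"
    by (auto simp: subspaces_dim_def intro: card_mono finite_vecs)
  then have "finite ?K" using finite_subset by blast
  moreover have "lspan {} \<in> (subspaces_dim m 0 :: (nat \<Rightarrow> 'a) set set)"
    unfolding subspaces_dim_def by (intro CollectI exI[of _ "{}"]) (auto simp: lin_indep_def)
  then have "0 \<in> ?K" by (auto simp: lspan_empty)
  ultimately have "Max ?K \<in> ?K" by (intro Max_in) auto
  then obtain E where E: "lin_indep E" "card E = p"
    "lspan E \<subseteq> direction_set m B \<union> {\<lambda>_. 0}"
    unfolding p_def omega_dir_def by (auto simp: subspaces_dim_def)
  have "finite E" "E \<noteq> {}" using E p by (auto simp: lin_indep_def)
  then obtain e where e: "e \<in> E" by blast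
  then have "e \<noteq> (\<lambda>_. 0)" using lin_indep_zero_notin[OF E(1)] by metis
  then have "e \<in> direction_set m B" using in_lspan[OF \<open>finite E\<close> e] E by blast
  then obtain x where x: "\<And>c. (\<lambda>i. x i + c * e i) \<in> B" by (auto simp: direction_set_def)
  then have "B \<noteq> {}" by blast
  \<comment> \<open>A line of \<open>B\<close> in a nonzero direction has two distinct points, as
    required for \<open>C \<ge> 2\<close>.\<close>
  have "(\<lambda>i. x i + 0 * e i) \<noteq> (\<lambda>i. x i + 1 * e i)"
    using \<open>e \<noteq> (\<lambda>_. 0)\<close> by (auto simp: fun_eq_iff)
  then have C: "2 \<le> C" using weakly_sidorenko_ge_2[OF assms(1,2) x x] by blast
  have bound: "real (ramsey_q TYPE('a) 2 t) \<le> (2 * C + 2 + p) * (t * C powr (t / p))"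
    if t: "1 \<le> t" for t
  proof -
    \<comment> \<open>Rounding up \<open>t / p\<close> gives \<open>p * k \<ge> t\<close>, while
      \<open>k \<le> t / p + 1\<close> costs only one further factor \<open>C\<close>, a
      constant.\<close>
    define k where "k = t div p + 1"
    define P where "P = C powr (t / p)"
    define n where "n = nat \<lceil>(real t + 1) * C ^ k\<rceil> + p * k"
    have "t mod p < p" using p by simp
    then have pk: "t \<le> p * k" "p * k \<le> t + p"
      using mult_div_mod_eq[of p t] unfolding k_def distrib_left by linarith+
    have "real (p * k) + (real t + 1) * C ^ k \<le> n"
      unfolding n_def by (simp add: real_nat_ceiling_ge)
    then have "ramsey_q TYPE('a) 2 t \<le> n"
      by (rule ramsey_q_le[OF assms(1) \<open>B \<noteq> {}\<close> assms(2) E C pk(1)])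
    then have "real (ramsey_q TYPE('a) 2 t) \<le> n" by simp
    also have "\<dots> \<le> (real t + 1) * C ^ k + 1 + real (p * k)"
      using C of_int_ceiling_le_add_one[of "(real t + 1) * C ^ k"] by (simp add: n_def)
    also have "\<dots> \<le> (2 * real t) * (C * P) + 1 + (real t + real p)"
    proof -
      have "C ^ k = C powr real k" using C by (simp add: powr_realpow)
      also have "\<dots> \<le> C powr (t / p + 1)"
        using C of_nat_div_le_of_nat[of t p] by (intro powr_mono) (auto simp: k_def)
      also have "\<dots> = C * P" using C by (simp add: P_def powr_add)
      finally have "(real t + 1) * C ^ k \<le> (2 * real t) * (C * P)"
        using t C by (intro mult_mono) auto
      moreover have "real (p * k) \<le> real t + real p" using pk(2) by linarith
      ultimately show ?thesis by linarith
    qed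
    \<comment> \<open>Each of \<open>t\<close>, 1 and \<open>p\<close> is absorbed by
      \<open>t * P\<close>, with factors 1, 1 and \<open>p\<close>, because \<open>t \<ge> 1\<close>
      and \<open>P \<ge> 1\<close>.\<close>
    also have "\<dots> \<le> (2 * C + 2 + p) * (t * P)"
    proof -
      have "1 \<le> P" unfolding P_def using C by (intro ge_one_powr_ge_zero) auto
      then have tP: "real t \<le> t * P" "1 \<le> t * P"
        using t mult_mono[of 1 "real t" 1 P] by auto
      then have "real p * 1 \<le> real p * (t * P)" by (intro mult_left_mono) auto
      then show ?thesis using tP by (simp add: algebra_simps)
    qed
    finally show ?thesis by (simp add: P_def)
  qed
  show ?thesis
  proof (rule bigoI)
    show "\<forall>\<^sub>F t in sequentially. norm (real (ramsey_q TYPE('a) 2 t))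
      \<le> (2 * C + 2 + p) * norm (real t * C powr (real t / real (omega_dir m B)))"
      using eventually_ge_at_top[of 1]
      by eventually_elim (use bound C in \<open>simp add: p_def\<close>)
  qed
qed

end
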